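(* Suppose $\mathcal Y=\mathbb R^k$ and $\mathbb P_{\hat\theta}$ admits a density. Let $\lambda>0$, $\delta\in(0,1)$, and consider the parametric divergence ball $\mathcal U_{data}=\{\mathbb Q: d_\phi(\mathbb P_{\hat\theta},\mathbb Q)\le\lambda,\ \mathbb Q\in\mathcal P_{para}\}$. Suppose $\mathbb P_0$ is a probability measure on $\mathcal Y$ such that $\mathcal D_{data}(\mathbb P_0,\phi)<\lambda$. Then $$\min_{\mathbb P_1}M(\mathbb P_1,\{\mathbb Q: d_\phi(\mathbb P_{\hat\theta},\mathbb Q)\le\lambda,\mathbb Q\in\mathcal P_{para}\},\delta)\le\min_{\mathbb P_1}M(\mathbb P_1,\{\mathbb Q: d_\phi(\mathbb P_0,\mathbb Q)\le\mathcal D_{data}(\mathbb P_0,\phi)\},\delta)\le\min_{\mathbb P_1}M(\mathbb P_1,\{\mathbb Q: d_\phi(\mathbb P_{\hat\theta},\mathbb Q)\le\lambda\},\delta)$$ and $$\min_{\mathbb P_1}M(\mathbb P_1,\{\mathbb Q: d_\phi(\mathbb P_{\hat\theta},\mathbb Q)\le\lambda,\mathbb Q\in\mathcal P_{para}\},\delta)\le{\epsilon'}^{-1}(\delta,\mathcal D_{data}(\mathbb P_0,\phi),\phi)\le{\epsilon'}^{-1}(\delta,\lambda,\phi),$$ where the minima (read as infima) are over probability measures $\mathbb P_1$ on $\mathcal Y$.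
   Context: $\mathcal P_{para}=\{\mathbb P_\theta\}_{\theta\in\Theta}$, $\Theta\subset\mathbb R^D$, is a parametric family of probability measures on $\mathcal Y$ containing $\mathbb P_{\hat\theta}$. $\phi:\mathbb R_+\to\mathbb R_+$ is convex with $\phi(1)=0$, twice continuously differentiable with $\phi''(1)\ne0$, extended by $\phi(x)=+\infty$ for $x<0$. For $\mathbb P_2\ll\mathbb P_1$, $d_\phi(\mathbb P_1,\mathbb P_2)=\int_{\mathcal Y}\phi(\frac{d\mathbb P_2}{d\mathbb P_1})d\mathbb P_1$; the balls $\{\mathbb Q: d_\phi(\mathbb P,\mathbb Q)\le r\}$ consist of probability measures $\mathbb Q\ll\mathbb P$. Define $$\mathcal D_{data}(\mathbb P_0,\phi)=\sup_{\mathbb Q\in\mathcal U_{data}}d_\phi(\mathbb P_0,\mathbb Q)$$ (equal to $+\infty$ if some $\mathbb Q\in\mathcal U_{data}$ is not absolutely continuous with respect to $\mathbb P_0$). For a probability measure $\mathbb P_1$, a set $\mathcal U$ of probability measures, and $\delta>0$, $$M(\mathbb P_1,\mathcal U,\delta)=\sup\{\mathbb Q(A):\ \mathbb Q\in\mathcal U,\ A\subset\mathcal Y\text{ measurable},\ \mathbb P_1(A)\le\delta\}.$$ Let $\phi^*(t)=\sup_x\{tx-\phi(x)\}$, $\underline m(\phi^* )=\sup\{m\in\mathbb R:\phi^*\text{ is a finite constant on }(-\infty,m]\}$ (with $\sup\emptyset=-\infty$), $\overline m(\phi^* )=\inf\{m\in\mathbb R:\phi^*(m)=+\infty\}$ (with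 $\inf\emptyset=+\infty$). For $0\le\epsilon<1$, $$\epsilon'(\epsilon,\lambda,\phi)=\max\left\{1-\inf_{\substack{z_0\in\mathbb R,\ z>0\\ \underline m(\phi^* )\le z_0+z\le\overline m(\phi^* )}}\frac{\phi^*(z_0+z)-z_0-\epsilon z+\lambda}{\phi^*(z_0+z)-\phi^*(z_0)},\ 0\right\},$$ where a quotient with zero denominator is read as $+\infty$ and only points with $\phi^*(z_0+z)<\infty$ are considered; and $\epsilon'(\epsilon,\lambda,\phi)=1$ for $\epsilon\ge1$. Finally ${\epsilon'}^{-1}(x,\lambda,\phi)=\min\{\epsilon\ge0:\ \epsilon'(\epsilon,\lambda,\phi)\ge x\}$. *)

theory Defs
  imports "HOL-Probability.Probability"
begin

text \<open>
  The generator is a total function \<open>\<phi> :: real \<Rightarrow> real\<close> of which only the values on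
  \<open>[0, \<infinity>)\<close> matter. Smoothness is required on \<open>(0, \<infinity>)\<close>, with mere continuity at \<open>0\<close>, so that
  generators such as \<open>x ln x - x + 1\<close>, which have no one-sided derivative at \<open>0\<close>, are included.
\<close>

definition divergence_generator :: "(real \<Rightarrow> real) \<Rightarrow> bool" where
  "divergence_generator \<phi> \<longleftrightarrow>
     (\<forall>x\<ge>0. 0 \<le> \<phi> x) \<and> convex_on {0..} \<phi> \<and> \<phi> 1 = 0 \<and>
     continuous_on {0..} \<phi> \<and>
     (\<forall>x>0. \<phi> differentiable (at x)) \<and>
     (\<forall>x>0. deriv \<phi> differentiable (at x)) \<and>
     continuous_on {0<..} (deriv (deriv \<phi>)) \<and>
     deriv (deriv \<phi>) 1 \<noteq> 0"

abbreviation prob_measures :: "'a::topological_space measure set" where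
  "prob_measures \<equiv> space (prob_algebra borel)"

definition phi_div :: "(real \<Rightarrow> real) \<Rightarrow> 'a measure \<Rightarrow> 'a measure \<Rightarrow> ereal" where
  "phi_div \<phi> P Q =
     (if absolutely_continuous P Q
      then enn2ereal (\<integral>\<^sup>+ y. ennreal (\<phi> (enn2real (RN_deriv P Q y))) \<partial>P)
      else \<infinity>)"

definition phi_ball ::
  "(real \<Rightarrow> real) \<Rightarrow> 'a::topological_space measure \<Rightarrow> ereal \<Rightarrow> 'a measure set" where
  "phi_ball \<phi> P r =
     {Q \<in> prob_measures. absolutely_continuous P Q \<and> phi_div \<phi> P Q \<le> r}"

text \<open>
  By the convention in \<open>phi_div\<close>, the supremum is \<open>\<infinity>\<close> as soon as some member of \<open>U\<close> is not
  absolutely continuous with respect to \<open>P\<^sub>0\<close>.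
\<close>

definition data_radius ::
  "'a measure set \<Rightarrow> 'a measure \<Rightarrow> (real \<Rightarrow> real) \<Rightarrow> ereal" where
  "data_radius U P\<^sub>0 \<phi> = (SUP Q\<in>U. phi_div \<phi> P\<^sub>0 Q)"

definition worst_mass :: "'a measure \<Rightarrow> 'a measure set \<Rightarrow> real \<Rightarrow> ereal" where
  "worst_mass P\<^sub>1 U \<delta> =
     Sup {ereal (measure Q A) | Q A. Q \<in> U \<and> A \<in> sets P\<^sub>1 \<and> measure P\<^sub>1 A \<le> \<delta>}"

definition phi_ext :: "(real \<Rightarrow> real) \<Rightarrow> real \<Rightarrow> ereal" where
  "phi_ext \<phi> x = (if x < 0 then \<infinity> else ereal (\<phi> x))"

definition phi_conj :: "(real \<Rightarrow> real) \<Rightarrow> real \<Rightarrow> ereal" where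
  "phi_conj \<phi> t = (SUP x. ereal (t * x) - phi_ext \<phi> x)"

definition m_lower :: "(real \<Rightarrow> real) \<Rightarrow> ereal" where
  "m_lower \<phi> = Sup {ereal m | m. \<exists>c::real. \<forall>t\<le>m. phi_conj \<phi> t = ereal c}"

definition m_upper :: "(real \<Rightarrow> real) \<Rightarrow> ereal" where
  "m_upper \<phi> = Inf {ereal m | m. phi_conj \<phi> m = \<infinity>}"

definition eps_quotient :: "real \<Rightarrow> ereal \<Rightarrow> (real \<Rightarrow> real) \<Rightarrow> real \<Rightarrow> real \<Rightarrow> ereal" where
  "eps_quotient \<epsilon> lam \<phi> z\<^sub>0 z =
     (if phi_conj \<phi> (z\<^sub>0 + z) - phi_conj \<phi> z\<^sub>0 = 0 then \<infinity>
      else (phi_conj \<phi> (z\<^sub>0 + z) - ereal z\<^sub>0 - ereal (\<epsilon> * z) + lam)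
             / (phi_conj \<phi> (z\<^sub>0 + z) - phi_conj \<phi> z\<^sub>0))"

definition eps_adj :: "real \<Rightarrow> ereal \<Rightarrow> (real \<Rightarrow> real) \<Rightarrow> ereal" where
  "eps_adj \<epsilon> lam \<phi> =
     (if 1 \<le> \<epsilon> then 1
      else max (1 - Inf {eps_quotient \<epsilon> lam \<phi> z\<^sub>0 z | z\<^sub>0 z.
                      0 < z \<and> m_lower \<phi> \<le> ereal (z\<^sub>0 + z) \<and> ereal (z\<^sub>0 + z) \<le> m_upper \<phi> \<and>
                      phi_conj \<phi> (z\<^sub>0 + z) < \<infinity>})
               0)"

text \<open>
  The minimum in the definition of the inverse is rendered by the infimum, which coincides with it
  whenever it is attained; for \<open>x \<le> 1\<close> the set below contains \<open>1\<close>.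
\<close>

definition eps_adj_inv :: "real \<Rightarrow> ereal \<Rightarrow> (real \<Rightarrow> real) \<Rightarrow> ereal" where
  "eps_adj_inv x lam \<phi> = Inf {ereal \<epsilon> | \<epsilon>. 0 \<le> \<epsilon> \<and> ereal x \<le> eps_adj \<epsilon> lam \<phi>}"

end

theory Submission
  imports Defs
begin

text \<open>
  Any radius \<open>r\<close> ball around \<open>P\<^sub>0\<close> is compared through the two-point divergence
  \<open>p \<phi>(q/p) + (1 - p) \<phi>((1 - q)/(1 - p))\<close>. By Jensen's inequality it is at most \<open>r\<close> at
  \<open>(P\<^sub>0 A, Q A)\<close> for every \<open>Q\<close> in the ball, and it decreases in \<open>p \<le> q\<close>, so it is at most \<open>r\<close> at
  \<open>(\<delta>, Q A)\<close> as well. Conversely, since the centre \<open>P\<close> of the other ball has no atoms,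
  every \<open>P\<^sub>1\<close> admits an event \<open>B\<close> with \<open>P B = \<delta>\<close> and \<open>P\<^sub>1 B \<le> \<delta>\<close>; tilting \<open>P\<close> by a two-valued
  density gives \<open>B\<close> the mass \<open>Q A\<close> at the cost of exactly this two-point divergence.
  The bound by the inverse of \<open>\<epsilon>'\<close> is weak duality for the two-point problem.
\<close>

section \<open>Splitting off prescribed mass\<close>

text \<open>Null level sets make the distribution function of \<open>u\<close> under the restriction
  of \<open>M\<close> to \<open>B\<close> continuous. It rises from 0 to \<open>measure M B\<close>,
  so some sublevel set of \<open>u\<close> cuts out mass exactly \<open>m\<close>.\<close>

lemma (in finite_measure) exists_subset_measure_eq:
  fixes u :: "'a \<Rightarrow> real"
  assumes u [measurable]: "u \<in> borel_measurable M"
    and null: "\<And>t. measure M {x \<in> space M. u x = t} = 0"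
    and B [measurable]: "B \<in> sets M" and m: "0 \<le> m" "m \<le> measure M B"
  shows "\<exists>A\<in>sets M. A \<subseteq> B \<and> measure M A = m"
proof (cases "m = 0 \<or> m = measure M B")
  case True
  then show ?thesis
    using B by (metis empty_subsetI measure_empty sets.empty_sets subset_refl)
next
  case False
  define N where "N = distr (density M (indicator B)) borel u"
  have N_eq: "measure N S = measure M (B \<inter> (u -` S \<inter> space M))" if [measurable]: "S \<in> sets borel" for S
  proof -
    have "emeasure N S = emeasure M (B \<inter> (u -` S \<inter> space M))"
      unfolding N_def by (subst emeasure_distr) (auto simp: emeasure_restricted)
    then show ?thesis
      by (simp add: measure_def)
  qed
  have "finite_measure (density M (indicator B))"
    using finite_measure_restricted[OF B] .
  then have "finite_measure N"
    unfolding N_def by (rule finite_measure.finite_measure_distr) simp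
  then interpret N: finite_borel_measure N
    by (simp add: finite_borel_measure_def finite_borel_measure_axioms_def N_def)
  have "measure N {t} = 0" for t
  proof -
    have "measure N {t} \<le> measure M {x \<in> space M. u x = t}"
      by (subst N_eq) (auto intro!: finite_measure_mono)
    then show ?thesis
      using null[of t] by (simp add: measure_le_0_iff)
  qed
  then have cont: "isCont (cdf N) t" for t
    by (simp add: N.isCont_cdf)
  have "measure N (space N) = measure M B"
    using N_eq[of UNIV] sets.sets_into_space[OF B] by (simp add: N_def Int_absorb2)
  then have top: "(cdf N \<longlongrightarrow> measure M B) at_top"
    using N.cdf_lim_at_top by simp
  have "eventually (\<lambda>t. cdf N t < m) at_bot"
    using order_tendstoD(2)[OF N.cdf_lim_at_bot, of m] m False by auto
  then obtain a where a: "\<And>t. t \<le> a \<Longrightarrow> cdf N t < m"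
    by (auto simp: eventually_at_bot_linorder)
  have "eventually (\<lambda>t. m < cdf N t) at_top"
    using order_tendstoD(1)[OF top, of m] m False by auto
  then obtain b where b: "\<And>t. b \<le> t \<Longrightarrow> m < cdf N t"
    by (auto simp: eventually_at_top_linorder)
  have "\<exists>t\<ge>a. t \<le> max a b \<and> cdf N t = m"
    using a[of a] b[of "max a b"] cont
    by (intro IVT) (auto intro: less_imp_le)
  then obtain t where "cdf N t = m"
    by blast
  then have "measure M (B \<inter> (u -` {..t} \<inter> space M)) = m"
    by (simp add: cdf_def N_eq)
  then show ?thesis
    by (intro bexI[of _ "B \<inter> (u -` {..t} \<inter> space M)"]) auto
qed

text \<open>
  A Neyman--Pearson type argument: fill up (or cut down) the positive set of the Hahn decomposition
  of \<open>M - N\<close> to mass exactly \<open>\<delta>\<close>.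
\<close>

lemma exists_event_dominating:
  fixes u :: "'a \<Rightarrow> real"
  assumes M: "prob_space M" and N: "prob_space N" and sets_eq: "sets N = sets M"
    and u: "u \<in> borel_measurable M"
    and null: "\<And>t. measure M {x \<in> space M. u x = t} = 0"
    and d: "0 \<le> d" "d \<le> 1"
  shows "\<exists>A\<in>sets M. measure M A = d \<and> measure N A \<le> d"
proof -
  interpret M: prob_space M by fact
  interpret N: prob_space N by fact
  obtain Y where Y: "Y \<in> sets M"
    and le: "\<And>X. X \<in> sets M \<Longrightarrow> X \<subseteq> Y \<Longrightarrow> emeasure N X \<le> emeasure M X"
    and ge: "\<And>X. X \<in> sets M \<Longrightarrow> X \<inter> Y = {} \<Longrightarrow> emeasure M X \<le> emeasure N X"
    using finite_unsigned_Hahn_decomposition[OF M.finite_measure_axioms N.finite_measure_axioms sets_eq]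
    by blast
  show ?thesis
  proof (cases "d \<le> measure M Y")
    case True
    then obtain A where A: "A \<in> sets M" "A \<subseteq> Y" "measure M A = d"
      using M.exists_subset_measure_eq[OF u null Y d(1)] by blast
    then show ?thesis
      using le[of A] by (auto simp: M.emeasure_eq_measure N.emeasure_eq_measure)
  next
    case False
    have "d - measure M Y \<le> measure M (space M - Y)"
      using d M.prob_compl[OF Y] by simp
    then obtain C where C: "C \<in> sets M" "C \<subseteq> space M - Y" "measure M C = d - measure M Y"
      using M.exists_subset_measure_eq[OF u null, of "space M - Y" "d - measure M Y"] Y False by auto
    have YC: "Y \<union> C \<in> sets M"
      using Y C by auto
    have M_eq: "measure M (Y \<union> C) = d"
      using C Y by (subst M.finite_measure_Union) auto
    \<comment> \<open>Outside \<open>Y\<close> the measure \<open>N\<close> dominates; as both total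
      masses are 1, taking complements reverses the inequality.\<close>
    have "measure M (space M - (Y \<union> C)) \<le> measure N (space M - (Y \<union> C))"
      using ge[of "space M - (Y \<union> C)"] YC by (auto simp: M.emeasure_eq_measure N.emeasure_eq_measure)
    then have "measure N (Y \<union> C) \<le> d"
      using M.prob_compl[OF YC] N.prob_compl[of "Y \<union> C"] YC M_eq sets_eq sets_eq_imp_space_eq[OF sets_eq]
      by simp
    then show ?thesis
      using YC M_eq by blast
  qed
qed

text \<open>Hyperplanes are Lebesgue null. This supplies linear functionals as functions
  \<open>u\<close> with null level sets, and is where the density of the centre enters.\<close>

lemma measure_hyperplane_density_lborel:
  fixes a :: "'a::euclidean_space"
  assumes f: "f \<in> borel_measurable lborel" and a: "a \<noteq> 0"
  shows "measure (density lborel f) {x. a \<bullet> x = t} = 0"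
proof -
  have [measurable]: "{x. a \<bullet> x = t} \<in> sets borel"
    by (intro borel_closed closed_hyperplane)
  have "{x. a \<bullet> x = t} \<in> null_sets lebesgue"
    using negligible_hyperplane[of a t] a by (simp add: negligible_iff_null_sets)
  then have "{x. a \<bullet> x = t} \<in> null_sets lborel"
    by (subst (asm) null_sets_completion_iff) simp_all
  then have "{x. a \<bullet> x = t} \<in> null_sets (density lborel f)"
    using absolutely_continuousI_density[OF f] by (auto simp: absolutely_continuous_def)
  then show ?thesis
    by (simp add: measure_def null_setsD1)
qed

section \<open>Two-point divergences\<close>

text \<open>The divergence of the Bernoulli law with parameter \<open>q\<close> from the reference
  law with parameter \<open>p\<close>; meaningful for 0 < p < 1.\<close>

definition binary_div :: "(real \<Rightarrow> real) \<Rightarrow> real \<Rightarrow> real \<Rightarrow> real" where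
  "binary_div \<phi> p q = p * \<phi> (q / p) + (1 - p) * \<phi> ((1 - q) / (1 - p))"

lemma divergence_generatorD:
  assumes "divergence_generator \<phi>"
  shows "\<And>x. 0 \<le> x \<Longrightarrow> 0 \<le> \<phi> x" "convex_on {0..} \<phi>" "\<phi> 1 = 0" "continuous_on {0..} \<phi>"
    "\<And>x. 0 < x \<Longrightarrow> \<phi> differentiable (at x)"
  using assms by (auto simp: divergence_generator_def)

text \<open>Supporting lines at interior points only: at 0 the slope may be infinite, as for x ln x
  - x + 1.\<close>

lemma divergence_generator_tangent:
  assumes "divergence_generator \<phi>" "0 < x"
  obtains c where "\<And>y. 0 \<le> y \<Longrightarrow> \<phi> x + c * (y - x) \<le> \<phi> y"
proof -
  note \<phi> = divergence_generatorD[OF assms(1)]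
  obtain c where "(\<phi> has_field_derivative c) (at x)"
    using \<phi>(5)[OF assms(2)] by (auto simp: real_differentiable_def)
  then have c: "(\<phi> has_field_derivative c) (at x within {0..})"
    by (rule has_field_derivative_at_within)
  have "\<phi> x + c * (y - x) \<le> \<phi> y" if "0 \<le> y" for y
    using convex_on_imp_above_tangent[OF \<phi>(2) _ _ _ c, of y] that assms(2) by simp
  then show thesis
    by (rule that)
qed

text \<open>Precomposition with \<open>max 0\<close> turns continuity on the half line into
  continuity everywhere and changes nothing on the range of \<open>h\<close>.\<close>

lemma measurable_divergence_generator:
  assumes "divergence_generator \<phi>" "h \<in> borel_measurable M" "\<And>x. 0 \<le> h x"
  shows "(\<lambda>x. \<phi> (h x)) \<in> borel_measurable M"
proof -
  have "continuous_on UNIV (\<lambda>x. \<phi> (max 0 x))"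
    by (rule continuous_on_compose2[OF divergence_generatorD(4)[OF assms(1)]])
      (auto intro!: continuous_intros)
  then have "(\<lambda>x. \<phi> (max 0 (h x))) \<in> borel_measurable M"
    by (rule borel_measurable_continuous_on[OF _ assms(2)])
  then show ?thesis
    using assms(3) by (simp add: max_absorb2)
qed

text \<open>Convexity with weights a/(a+b) and b/(a+b), scaled by a+b: the perspective of \<phi> is
  subadditive.\<close>

lemma perspective_le:
  fixes a b x y :: real
  assumes "convex_on {0..} \<phi>" "0 \<le> a" "0 \<le> b" "0 < a + b" "0 \<le> x" "0 \<le> y"
  shows "(a + b) * \<phi> ((a * x + b * y) / (a + b)) \<le> a * \<phi> x + b * \<phi> y"
proof -
  let ?u = "a / (a + b)" and ?v = "b / (a + b)"
  have uv: "0 \<le> ?u" "0 \<le> ?v" "?u + ?v = 1"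
    using assms by (auto simp: add_divide_distrib[symmetric])
  have "\<phi> (?u *\<^sub>R x + ?v *\<^sub>R y) \<le> ?u * \<phi> x + ?v * \<phi> y"
    using assms(1,5,6) uv unfolding convex_on_def by blast
  then have "(a + b) * \<phi> (?u * x + ?v * y) \<le> (a + b) * (?u * \<phi> x + ?v * \<phi> y)"
    using assms(4) by simp
  moreover have "(a + b) * ?u = a" "(a + b) * ?v = b"
    using assms(4) by simp_all
  then have "(a + b) * (?u * \<phi> x + ?v * \<phi> y) = a * \<phi> x + b * \<phi> y"
    by (simp only: distrib_left mult.assoc[symmetric])
  moreover have "?u * x + ?v * y = (a * x + b * y) / (a + b)"
    by (simp add: add_divide_distrib)
  ultimately show ?thesis
    by simp
qed

text \<open>The point \<open>(p, q)\<close> lies on the segment from \<open>(p', q)\<close> to the zero \<open>(q, q)\<close> of the jointly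
  convex function \<open>binary_div \<phi>\<close>.\<close>

lemma binary_div_antimono:
  assumes gen: "divergence_generator \<phi>" and p: "0 < p'" "p' \<le> p" "p < q" "q \<le> 1"
  shows "binary_div \<phi> p q \<le> binary_div \<phi> p' q"
proof -
  note \<phi> = divergence_generatorD[OF gen]
  \<comment> \<open>The weight that writes \<open>p\<close> as a convex combination of
    \<open>p'\<close> and \<open>q\<close>.\<close>
  define s where "s = (q - p) / (q - p')"
  have s: "0 < s" "s \<le> 1" and "s * (q - p') = q - p"
    using p by (auto simp: s_def)
  then have seq: "s * p' + (1 - s) * q = p"
    by (simp add: algebra_simps)
  have seq': "s * (1 - p') + (1 - s) * (1 - q) = 1 - p"
    using seq by (simp add: algebra_simps)
  have pos: "0 \<le> (1 - s) * (1 - q)" "0 \<le> (1 - s) * q"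
    using p s by auto
  \<comment> \<open>The diagonal endpoint has likelihood ratio 1, where \<phi> vanishes, so only the
    term of \<open>p'\<close> survives.\<close>
  have "s * p' * (q / p') + (1 - s) * q * 1 = q"
    using p by (simp add: algebra_simps)
  then have 1: "p * \<phi> (q / p) \<le> s * p' * \<phi> (q / p')"
    using perspective_le[OF \<phi>(2), of "s * p'" "(1 - s) * q" "q / p'" 1, unfolded seq] p s pos \<phi>(3)
    by simp
  have "(1 - p') * ((1 - q) / (1 - p')) = 1 - q"
    using p by simp
  then have "s * (1 - p') * ((1 - q) / (1 - p')) + (1 - s) * (1 - q) * 1 = 1 - q"
    by (simp only: mult.assoc) (simp add: algebra_simps)
  then have 2: "(1 - p) * \<phi> ((1 - q) / (1 - p)) \<le> s * (1 - p') * \<phi> ((1 - q) / (1 - p'))"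
    using perspective_le[OF \<phi>(2), of "s * (1 - p')" "(1 - s) * (1 - q)" "(1 - q) / (1 - p')" 1,
        unfolded seq'] p s pos \<phi>(3)
    by simp
  have "0 \<le> p' * \<phi> (q / p')" "0 \<le> (1 - p') * \<phi> ((1 - q) / (1 - p'))"
    using p by (auto intro!: mult_nonneg_nonneg \<phi>(1))
  then have "0 \<le> binary_div \<phi> p' q"
    by (simp add: binary_div_def)
  moreover have "binary_div \<phi> p q \<le> s * binary_div \<phi> p' q"
    using 1 2 by (simp add: binary_div_def algebra_simps)
  ultimately show ?thesis
    using s mult_right_mono[of s 1 "binary_div \<phi> p' q"] by simp
qed

text \<open>Integrate over \<open>A\<close> the supporting line of \<phi> at the mean of
  \<open>h\<close> on \<open>A\<close>.\<close>

lemma jensen_on_event: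
  assumes gen: "divergence_generator \<phi>" and M: "finite_measure M" and A [measurable]: "A \<in> sets M"
    and h: "integrable M h" "\<And>x. 0 \<le> h x" and \<phi>h: "integrable M (\<lambda>x. \<phi> (h x))"
    and p: "0 < measure M A"
  shows "measure M A * \<phi> ((\<integral>x\<in>A. h x \<partial>M) / measure M A) \<le> (\<integral>x\<in>A. \<phi> (h x) \<partial>M)"
proof -
  interpret finite_measure M by fact
  let ?p = "measure M A" and ?q = "\<integral>x\<in>A. h x \<partial>M"
  have ih: "set_integrable M A h" and i\<phi>: "set_integrable M A (\<lambda>x. \<phi> (h x))"
    using integrable_mult_indicator[OF A h(1)] integrable_mult_indicator[OF A \<phi>h]
    by (auto simp: set_integrable_def)
  have ic: "set_integrable M A (\<lambda>x. c)" for c :: real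
    using integrable_mult_indicator[OF A integrable_const[of c]] by (auto simp: set_integrable_def)
  have int_c: "(\<integral>x\<in>A. c \<partial>M) = ?p * c" for c :: real
    by (simp add: set_lebesgue_integral_def Int_absorb2 sets.sets_into_space[OF A])
  have "0 \<le> ?q"
    using h(2) by (auto simp: set_lebesgue_integral_def intro!: integral_nonneg_AE)
  show ?thesis
  proof (cases "?q = 0")
    \<comment> \<open>No supporting line is at hand at 0, but mean 0 forces \<open>h = 0\<close>
      almost everywhere on \<open>A\<close>, and equality holds.\<close>
    case True
    then have "AE x in M. indicator A x *\<^sub>R h x = 0"
      using integral_nonneg_eq_0_iff_AE[of M "\<lambda>x. indicator A x *\<^sub>R h x"] ih h(2)
      by (auto simp: set_lebesgue_integral_def set_integrable_def)
    then have "(\<integral>x\<in>A. \<phi> (h x) \<partial>M) = (\<integral>x\<in>A. \<phi> 0 \<partial>M)"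
      unfolding set_lebesgue_integral_def
      using i\<phi> ic[of "\<phi> 0"] by (intro integral_cong_AE) (auto simp: set_integrable_def indicator_def)
    then show ?thesis
      using True int_c by simp
  next
    case False
    then have x: "0 < ?q / ?p"
      using \<open>0 \<le> ?q\<close> p by simp
    then obtain c where c: "\<And>y. 0 \<le> y \<Longrightarrow> \<phi> (?q / ?p) + c * (y - ?q / ?p) \<le> \<phi> y"
      using divergence_generator_tangent[OF gen] by blast
    let ?k = "\<phi> (?q / ?p) - c * (?q / ?p)"
    have ich: "set_integrable M A (\<lambda>x. c * h x)"
      using ih by simp
    have "(\<integral>x\<in>A. ?k + c * h x \<partial>M) \<le> (\<integral>x\<in>A. \<phi> (h x) \<partial>M)"
      using c[OF h(2)] by (intro set_integral_mono set_integral_add ic ich i\<phi>) (simp_all add: algebra_simps)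
    moreover have "(\<integral>x\<in>A. ?k + c * h x \<partial>M) = ?p * ?k + c * ?q"
      by (subst set_integral_add(2)[OF ic ich]) (simp add: int_c)
    moreover have "?p * ?k + c * ?q = ?p * \<phi> (?q / ?p)"
      using p by (simp add: field_simps)
    ultimately show ?thesis
      by simp
  qed
qed

text \<open>Data processing: merging the space into \<open>A\<close> and its complement cannot
  increase the divergence, by Jensen's inequality on each piece for the density of
  \<open>Q\<close>.\<close>

lemma binary_div_le_phi_div:
  assumes gen: "divergence_generator \<phi>" and P: "prob_space P" and Q: "prob_space Q"
    and sets_eq: "sets Q = sets P" and ac: "absolutely_continuous P Q"
    and r: "phi_div \<phi> P Q \<le> ereal r"
    and A: "A \<in> sets P" and p: "0 < measure P A" "measure P A < 1"
  shows "binary_div \<phi> (measure P A) (measure Q A) \<le> r"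
proof -
  interpret P: prob_space P by fact
  interpret Q: prob_space Q by fact
  note \<phi> = divergence_generatorD[OF gen]
  define h where "h x = enn2real (RN_deriv P Q x)" for x
  have hm [measurable]: "h \<in> borel_measurable P" and h0: "0 \<le> h x" for x
    by (auto simp: h_def[abs_def])
  \<comment> \<open>The derivative is finite almost everywhere, so passing to the real-valued
    \<open>h\<close> loses nothing.\<close>
  have "AE x in P. RN_deriv P Q x = ennreal (h x)"
    using P.RN_deriv_finite[OF Q.sigma_finite_measure_axioms ac sets_eq]
    by eventually_elim (simp add: h_def ennreal_enn2real_if)
  then have Q_eq: "Q = density P (\<lambda>x. ennreal (h x))"
    using P.density_RN_deriv[OF ac sets_eq] density_cong[of "RN_deriv P Q" P "\<lambda>x. ennreal (h x)"]
    by simp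
  have Qint: "integrable P (\<lambda>x. h x * indicator B x)" "(\<integral>x\<in>B. h x \<partial>P) = measure Q B"
    if B [measurable]: "B \<in> sets P" for B
  proof -
    have "integrable Q (indicator B :: _ \<Rightarrow> real)"
      using that sets_eq by (intro Q.integrable_const_bound[of _ 1]) (auto simp: indicator_def)
    then show "integrable P (\<lambda>x. h x * indicator B x)"
      unfolding Q_eq by (subst (asm) integrable_density) (auto simp: h0)
    have "measure Q B = (\<integral>x. indicator B x \<partial>Q)"
      using that sets.sets_into_space[of B Q] by (simp add: sets_eq Int_absorb2)
    also have "\<dots> = (\<integral>x. h x *\<^sub>R indicator B x \<partial>P)"
      unfolding Q_eq by (subst integral_density) (auto simp: h0)
    finally show "(\<integral>x\<in>B. h x \<partial>P) = measure Q B"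
      by (simp add: set_lebesgue_integral_def mult.commute)
  qed
  have ih: "integrable P h"
    using Qint(1)[OF sets.top] Bochner_Integration.integrable_cong[of P P h "\<lambda>x. h x * indicator (space P) x"]
    by simp
  have \<phi>m [measurable]: "(\<lambda>x. \<phi> (h x)) \<in> borel_measurable P"
    by (rule measurable_divergence_generator[OF gen hm h0])
  have bound: "(\<integral>\<^sup>+x. ennreal (\<phi> (h x)) \<partial>P) \<le> ennreal r" and r0: "0 \<le> r"
  proof -
    have le: "enn2ereal (\<integral>\<^sup>+x. ennreal (\<phi> (h x)) \<partial>P) \<le> ereal r"
      using r ac by (simp add: phi_div_def h_def)
    then show "0 \<le> r"
      using enn2ereal_nonneg order_trans ereal_less_eq(5) by blast
    then show "(\<integral>\<^sup>+x. ennreal (\<phi> (h x)) \<partial>P) \<le> ennreal r"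
      using le by (simp add: less_eq_ennreal.rep_eq enn2ereal_ennreal)
  qed
  have i\<phi>: "integrable P (\<lambda>x. \<phi> (h x))"
    using bound \<phi>(1)[OF h0] by (intro integrableI_bounded) (auto simp: top_unique less_top[symmetric] intro: le_less_trans)
  have int_le: "(\<integral>x. \<phi> (h x) \<partial>P) \<le> r"
    using bound r0 \<phi>(1)[OF h0] by (subst (asm) nn_integral_eq_integral[OF i\<phi>]) auto
  have cA: "space P - A \<in> sets P" and pc: "measure P (space P - A) = 1 - measure P A"
    using A P.prob_compl by auto
  have qc: "measure Q (space P - A) = 1 - measure Q A"
    using Q.prob_compl[of A] A sets_eq sets_eq_imp_space_eq[OF sets_eq] by simp
  have "binary_div \<phi> (measure P A) (measure Q A)
    \<le> (\<integral>x\<in>A. \<phi> (h x) \<partial>P) + (\<integral>x\<in>space P - A. \<phi> (h x) \<partial>P)"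
    using jensen_on_event[OF gen P.finite_measure_axioms A ih h0 i\<phi>]
      jensen_on_event[OF gen P.finite_measure_axioms cA ih h0 i\<phi>] p
    by (simp add: Qint(2)[OF A] Qint(2)[OF cA] pc qc binary_div_def)
  also have "\<dots> = (\<integral>x\<in>A \<union> (space P - A). \<phi> (h x) \<partial>P)"
    using integrable_mult_indicator[OF A i\<phi>] integrable_mult_indicator[OF cA i\<phi>]
    by (intro set_integral_Un[symmetric]) (auto simp: set_integrable_def)
  also have "A \<union> (space P - A) = space P"
    using sets.sets_into_space[OF A] by auto
  also have "(\<integral>x\<in>space P. \<phi> (h x) \<partial>P) = (\<integral>x. \<phi> (h x) \<partial>P)"
    by (rule set_integral_space[OF i\<phi>])
  finally show ?thesis
    using int_le by simp
qed

text \<open>Almost everywhere uniqueness of the Radon-Nikodym derivative lets the divergence be read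
  off an explicit density.\<close>

lemma phi_div_density:
  assumes P: "prob_space P" and f [measurable]: "f \<in> borel_measurable P" and f0: "\<And>x. 0 \<le> f x"
  shows "phi_div \<phi> P (density P (\<lambda>x. ennreal (f x))) = enn2ereal (\<integral>\<^sup>+x. ennreal (\<phi> (f x)) \<partial>P)"
proof -
  interpret P: prob_space P by fact
  have "AE x in P. ennreal (f x) = RN_deriv P (density P (\<lambda>x. ennreal (f x))) x"
    by (rule P.RN_deriv_unique) auto
  then have "AE x in P. enn2real (RN_deriv P (density P (\<lambda>x. ennreal (f x))) x) = f x"
    by eventually_elim (metis enn2real_ennreal f0)
  then have "(\<integral>\<^sup>+x. ennreal (\<phi> (enn2real (RN_deriv P (density P (\<lambda>x. ennreal (f x))) x))) \<partial>P)
      = (\<integral>\<^sup>+x. ennreal (\<phi> (f x)) \<partial>P)"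
    by (intro nn_integral_cong_AE) auto
  then show ?thesis
    by (simp add: phi_div_def absolutely_continuousI_density)
qed

text \<open>The density is constant on \<open>A\<close> and on its complement, the case of equality
  in Jensen's inequality, so the bound of \<open>binary_div_le_phi_div\<close> is attained.\<close>

lemma exists_two_point_tilt:
  assumes gen: "divergence_generator \<phi>" and P: "prob_space P" and A [measurable]: "A \<in> sets P"
    and p: "0 < measure P A" "measure P A < 1" and q: "0 \<le> q" "q \<le> 1"
  shows "\<exists>Q. prob_space Q \<and> sets Q = sets P \<and> absolutely_continuous P Q \<and>
    measure Q A = q \<and> phi_div \<phi> P Q = ereal (binary_div \<phi> (measure P A) q)"
proof -
  interpret P: prob_space P by fact
  note \<phi> = divergence_generatorD[OF gen]
  let ?p = "measure P A"
  define f where "f x = (if x \<in> A then q / ?p else (1 - q) / (1 - ?p))" for x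
  define Q where "Q = density P (\<lambda>x. ennreal (f x))"
  have f [measurable]: "f \<in> borel_measurable P"
    unfolding f_def by measurable
  have f0: "0 \<le> f x" for x
    using p q by (simp add: f_def)
  have split: "(\<integral>\<^sup>+x. ennreal (if x \<in> A then a else b) \<partial>P) = ennreal (?p * a + (1 - ?p) * b)"
    if "0 \<le> a" "0 \<le> b" for a b
  proof -
    have "(\<integral>\<^sup>+x. ennreal (if x \<in> A then a else b) \<partial>P)
      = (\<integral>\<^sup>+x. ennreal a * indicator A x + ennreal b * indicator (space P - A) x \<partial>P)"
      by (intro nn_integral_cong) (auto simp: indicator_def)
    also have "\<dots> = ennreal a * emeasure P A + ennreal b * emeasure P (space P - A)"
      by (subst nn_integral_add) (auto simp: nn_integral_cmult_indicator)
    also have "\<dots> = ennreal (?p * a + (1 - ?p) * b)"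
      using that p by (simp add: P.emeasure_eq_measure P.prob_compl ennreal_mult ennreal_plus mult.commute)
    finally show ?thesis .
  qed
  have "emeasure Q (space Q) = (\<integral>\<^sup>+x. ennreal (f x) \<partial>P)"
    unfolding Q_def by (subst emeasure_density) (auto intro!: nn_integral_cong)
  also have "\<dots> = 1"
    unfolding f_def using p q by (subst split) auto
  finally have "prob_space Q"
    by (rule prob_spaceI)
  moreover have "measure Q A = q"
  proof -
    have "emeasure Q A = (\<integral>\<^sup>+x. ennreal (if x \<in> A then q / ?p else 0) \<partial>P)"
      unfolding Q_def by (subst emeasure_density) (auto intro!: nn_integral_cong simp: f_def indicator_def)
    also have "\<dots> = ennreal q"
      using p q by (subst split) auto
    finally show ?thesis
      using q by (simp add: measure_def)
  qed
  moreover have "phi_div \<phi> P Q = ereal (binary_div \<phi> ?p q)"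
  proof -
    have "(\<integral>\<^sup>+x. ennreal (\<phi> (f x)) \<partial>P)
      = (\<integral>\<^sup>+x. ennreal (if x \<in> A then \<phi> (q / ?p) else \<phi> ((1 - q) / (1 - ?p))) \<partial>P)"
      by (intro nn_integral_cong) (simp add: f_def)
    also have "\<dots> = ennreal (binary_div \<phi> ?p q)"
      using p q by (subst split) (auto simp: binary_div_def intro!: \<phi>(1))
    finally have "(\<integral>\<^sup>+x. ennreal (\<phi> (f x)) \<partial>P) = ennreal (binary_div \<phi> ?p q)" .
    moreover have "0 \<le> binary_div \<phi> ?p q"
      using p q by (auto simp: binary_div_def intro!: add_nonneg_nonneg mult_nonneg_nonneg \<phi>(1))
    ultimately show ?thesis
      unfolding Q_def by (simp add: phi_div_density[OF P f f0] enn2ereal_ennreal)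
  qed
  moreover have "absolutely_continuous P Q" "sets Q = sets P"
    by (simp_all add: Q_def absolutely_continuousI_density)
  ultimately show ?thesis
    by blast
qed

section \<open>Worst-case masses of divergence balls\<close>

lemma in_phi_ballD:
  assumes "Q \<in> phi_ball \<phi> P r"
  shows "sets Q = sets borel" "prob_space Q" "absolutely_continuous P Q" "phi_div \<phi> P Q \<le> r"
  using assms by (auto simp: phi_ball_def space_prob_algebra)

lemma phi_div_self:
  assumes "divergence_generator \<phi>" "prob_space P"
  shows "phi_div \<phi> P P = 0"
  using phi_div_density[OF assms(2), of "\<lambda>_. 1" \<phi>] divergence_generatorD(3)[OF assms(1)]
  by (simp add: density_1 zero_ennreal.rep_eq)

lemma self_in_phi_ball:
  assumes "divergence_generator \<phi>" "P \<in> prob_measures" "0 \<le> r"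
  shows "P \<in> phi_ball \<phi> P r"
  using assms phi_div_self[of \<phi> P]
  by (auto simp: phi_ball_def space_prob_algebra absolutely_continuous_def)

lemma worst_mass_mono: "U \<subseteq> V \<Longrightarrow> worst_mass P\<^sub>1 U \<delta> \<le> worst_mass P\<^sub>1 V \<delta>"
  unfolding worst_mass_def by (intro Sup_subset_mono) blast

text \<open>The left side is tested by its own centre, the right side by an arbitrary
  \<open>P\<^sub>1\<close>, as a comparison with an infimum requires. One event \<open>B\<close>,
  fixed in advance, serves all \<open>Q\<close> and \<open>A\<close>.\<close>

lemma worst_mass_phi_ball_le:
  fixes P P\<^sub>0 P\<^sub>1 :: "'a::topological_space measure" and u :: "'a \<Rightarrow> real"
  assumes gen: "divergence_generator \<phi>"
    and P: "P \<in> prob_measures" and P0: "P\<^sub>0 \<in> prob_measures" and P1: "P\<^sub>1 \<in> prob_measures"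
    and u: "u \<in> borel_measurable borel" and null: "\<And>t. measure P {x. u x = t} = 0"
    and \<delta>: "0 < \<delta>" "\<delta> < 1" and r: "0 \<le> r" "r \<le> r'"
  shows "worst_mass P\<^sub>0 (phi_ball \<phi> P\<^sub>0 (ereal r)) \<delta> \<le> worst_mass P\<^sub>1 (phi_ball \<phi> P (ereal r')) \<delta>"
proof -
  have ps: "prob_space P" "prob_space P\<^sub>0" "prob_space P\<^sub>1"
    and sets: "sets P = sets borel" "sets P\<^sub>0 = sets borel" "sets P\<^sub>1 = sets borel"
    using P P0 P1 by (auto simp: space_prob_algebra)
  have "space P = UNIV"
    using sets_eq_imp_space_eq[OF sets(1)] by simp
  then obtain B where B: "B \<in> sets P" "measure P B = \<delta>" "measure P\<^sub>1 B \<le> \<delta>"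
    using exists_event_dominating[OF ps(1,3), of u \<delta>] u null sets \<delta>
    by (auto simp: measurable_cong_sets[OF sets(1) refl])
  have "ereal (measure Q A) \<le> worst_mass P\<^sub>1 (phi_ball \<phi> P (ereal r')) \<delta>"
    if Q: "Q \<in> phi_ball \<phi> P\<^sub>0 (ereal r)" and A: "A \<in> sets P\<^sub>0" "measure P\<^sub>0 A \<le> \<delta>" for Q A
  proof -
    note Q' = in_phi_ballD[OF Q]
    let ?q = "measure Q A"
    have q: "0 \<le> ?q" "?q \<le> 1"
      using Q'(2) by (auto simp: prob_space.prob_le_1)
    have "\<exists>R\<in>phi_ball \<phi> P (ereal r'). ?q \<le> measure R B"
    proof (cases "?q \<le> \<delta>")
      case True
      then show ?thesis
        using self_in_phi_ball[OF gen P, of "ereal r'"] B(2) r by (intro bexI[of _ P]) auto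
    next
      case False
      \<comment> \<open>An event null for \<open>P\<^sub>0\<close> is null for \<open>Q\<close>,
        against \<open>?q > \<delta> > 0\<close>.\<close>
      have "measure P\<^sub>0 A \<noteq> 0"
      proof
        assume "measure P\<^sub>0 A = 0"
        then have "A \<in> null_sets P\<^sub>0"
          using A(1) ps(2) by (intro null_setsI) (auto simp: finite_measure.emeasure_eq_measure prob_space_def)
        then have "A \<in> null_sets Q"
          using Q'(3) by (auto simp: absolutely_continuous_def)
        then show False
          using False \<delta>(1) by (simp add: measure_def null_setsD1)
      qed
      then have p: "0 < measure P\<^sub>0 A"
        using measure_nonneg[of P\<^sub>0 A] by linarith
      \<comment> \<open>The reference mass is raised to \<open>\<delta>\<close>, the mass of
        \<open>B\<close> under \<open>P\<close>, so that the tilt of \<open>P\<close> along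
        \<open>B\<close> stays in the ball.\<close>
      have "binary_div \<phi> \<delta> ?q \<le> binary_div \<phi> (measure P\<^sub>0 A) ?q"
        using False p A(2) q by (intro binary_div_antimono[OF gen]) auto
      also have "\<dots> \<le> r"
        using Q' sets p A \<delta> by (intro binary_div_le_phi_div[OF gen ps(2)]) auto
      finally have "binary_div \<phi> \<delta> ?q \<le> r'"
        using r(2) by simp
      moreover obtain R where "prob_space R" "sets R = sets P" "absolutely_continuous P R"
        "measure R B = ?q" "phi_div \<phi> P R = ereal (binary_div \<phi> \<delta> ?q)"
        using exists_two_point_tilt[OF gen ps(1) B(1), of ?q] B(2) \<delta> q by auto
      ultimately show ?thesis
        using sets by (intro bexI[of _ R]) (auto simp: phi_ball_def space_prob_algebra)
    qed
    then obtain R where R: "R \<in> phi_ball \<phi> P (ereal r')" "?q \<le> measure R B"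
      by blast
    have "ereal (measure R B) \<le> worst_mass P\<^sub>1 (phi_ball \<phi> P (ereal r')) \<delta>"
      unfolding worst_mass_def using R(1) B sets by (intro Sup_upper) blast
    then show ?thesis
      using R(2) by (meson ereal_less_eq(3) order_trans)
  qed
  then show ?thesis
    by (subst worst_mass_def) (auto intro!: Sup_least)
qed

section \<open>The adjusted level\<close>

lemma phi_conj_ge: "0 \<le> x \<Longrightarrow> ereal (t * x - \<phi> x) \<le> phi_conj \<phi> t"
  unfolding phi_conj_def by (rule SUP_upper2[of x]) (simp_all add: phi_ext_def)

lemma phi_conj_mono:
  assumes "s \<le> t"
  shows "phi_conj \<phi> s \<le> phi_conj \<phi> t"
  unfolding phi_conj_def
proof (rule SUP_mono')
  show "ereal (s * x) - phi_ext \<phi> x \<le> ereal (t * x) - phi_ext \<phi> x" for x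
    using assms by (cases "x < 0") (auto simp: phi_ext_def mult_right_mono)
qed

text \<open>Testing the conjugate at 1, where \<phi> vanishes, bounds it below by \<open>t\<close>
  at every slope \<open>t\<close>; monotonicity carries finiteness from \<open>z\<^sub>0 + z\<close>
  to \<open>z\<^sub>0\<close>. Quotients can then be computed in the reals.\<close>

lemma phi_conj_finite_cases:
  assumes gen: "divergence_generator \<phi>" and z: "0 < z" and fin: "phi_conj \<phi> (z\<^sub>0 + z) < \<infinity>"
  obtains a b where "phi_conj \<phi> (z\<^sub>0 + z) = ereal a" "phi_conj \<phi> z\<^sub>0 = ereal b"
    "z\<^sub>0 + z \<le> a" "z\<^sub>0 \<le> b" "b \<le> a"
proof -
  have ge: "ereal t \<le> phi_conj \<phi> t" for t
    using phi_conj_ge[of 1 t \<phi>] divergence_generatorD(3)[OF gen] by simp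
  have le: "phi_conj \<phi> z\<^sub>0 \<le> phi_conj \<phi> (z\<^sub>0 + z)"
    using z by (intro phi_conj_mono) simp
  obtain a where a: "phi_conj \<phi> (z\<^sub>0 + z) = ereal a"
    using fin ge[of "z\<^sub>0 + z"] by (cases "phi_conj \<phi> (z\<^sub>0 + z)") auto
  moreover obtain b where "phi_conj \<phi> z\<^sub>0 = ereal b"
    using le a ge[of "z\<^sub>0"] by (cases "phi_conj \<phi> z\<^sub>0") auto
  ultimately show thesis
    using that le ge[of "z\<^sub>0 + z"] ge[of z\<^sub>0] by auto
qed

lemma eps_quotient_eq:
  assumes "phi_conj \<phi> (z\<^sub>0 + z) = ereal a" "phi_conj \<phi> z\<^sub>0 = ereal b"
  shows "eps_quotient \<epsilon> (ereal d) \<phi> z\<^sub>0 z =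
    (if a = b then \<infinity> else ereal ((a - z\<^sub>0 - \<epsilon> * z + d) / (a - b)))"
  using assms by (simp add: eps_quotient_def zero_ereal_def)

text \<open>The Fenchel-Young inequality at slope \<open>z\<^sub>0 + z\<close> and point
  \<open>q / p\<close>, weighted by \<open>p\<close>, is added to the one at slope
  \<open>z\<^sub>0\<close> and point \<open>(1 - q) / (1 - p)\<close>, weighted by
  \<open>1 - p\<close>. Here \<open>z\<^sub>0\<close> is the multiplier of the total mass and
  \<open>z\<close> that of the mass of the event.\<close>

lemma phi_conj_weak_duality:
  assumes p: "0 < p" "p < 1" and q: "0 \<le> q" "q \<le> 1"
    and a: "phi_conj \<phi> (z\<^sub>0 + z) = ereal a" and b: "phi_conj \<phi> z\<^sub>0 = ereal b"
  shows "(1 - p) * (a - b) \<le> a - z\<^sub>0 - q * z + binary_div \<phi> p q"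
proof -
  have "(z\<^sub>0 + z) * (q / p) - \<phi> (q / p) \<le> a"
    using phi_conj_ge[of "q / p" "z\<^sub>0 + z" \<phi>] p q a by simp
  then have "p * ((z\<^sub>0 + z) * (q / p) - \<phi> (q / p)) \<le> p * a"
    using p by simp
  then have 1: "(z\<^sub>0 + z) * q - p * \<phi> (q / p) \<le> p * a"
    using p by (simp add: right_diff_distrib)
  have "z\<^sub>0 * ((1 - q) / (1 - p)) - \<phi> ((1 - q) / (1 - p)) \<le> b"
    using phi_conj_ge[of "(1 - q) / (1 - p)" "z\<^sub>0" \<phi>] p q b by simp
  then have "(1 - p) * (z\<^sub>0 * ((1 - q) / (1 - p)) - \<phi> ((1 - q) / (1 - p))) \<le> (1 - p) * b"
    using p by simp
  moreover have "(1 - p) * ((1 - q) / (1 - p)) = 1 - q"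
    using p by simp
  ultimately have 2: "z\<^sub>0 * (1 - q) - (1 - p) * \<phi> ((1 - q) / (1 - p)) \<le> (1 - p) * b"
    by (simp only: right_diff_distrib mult.left_commute[of "1 - p" z\<^sub>0])
  show ?thesis
    using 1 2 by (simp add: binary_div_def algebra_simps)
qed

text \<open>
  Weak duality alone only bounds the quotient by \<open>1 - p \<ge> 1 - \<delta>\<close>, whereas excluding \<open>\<epsilon> < q\<close> needs a
  bound strictly above \<open>1 - \<delta>\<close>. The slack in \<open>q\<close> is traded for slack in \<open>p\<close> by moving \<open>(p, q)\<close>
  slightly towards the diagonal point \<open>(p / 2, p / 2)\<close>, where the divergence vanishes.
\<close>

lemma le_eps_adj_inv:
  assumes gen: "divergence_generator \<phi>" and p: "0 < p" "p \<le> \<delta>" "\<delta> < 1" and q: "0 \<le> q" "q \<le> 1"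
    and d: "0 \<le> d" "binary_div \<phi> p q \<le> d"
  shows "ereal q \<le> eps_adj_inv \<delta> (ereal d) \<phi>"
proof -
  have "q \<le> \<epsilon>" if \<epsilon>: "0 \<le> \<epsilon>" "ereal \<delta> \<le> eps_adj \<epsilon> (ereal d) \<phi>" for \<epsilon>
  proof (rule ccontr)
    assume "\<not> q \<le> \<epsilon>"
    define s where "s = q - \<epsilon>"
    have s: "0 < s" "s \<le> 1"
      using \<open>\<not> q \<le> \<epsilon>\<close> \<epsilon>(1) q by (auto simp: s_def)
    \<comment> \<open>First coordinate of the point at fraction \<open>s\<close> of the way from
      \<open>(p, q)\<close> to \<open>(p / 2, p / 2)\<close>; lying below
      \<open>p \<le> \<delta>\<close>, it will contradict \<open>\<delta> \<le> p'\<close>.\<close>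
    define p' where "p' = (1 - s) * p + s * (p / 2)"
    have p': "0 < p'" "p' < p"
      using s p by (auto simp: p'_def algebra_simps intro!: add_nonneg_pos)
    have "ereal (1 - p') \<le> eps_quotient \<epsilon> (ereal d) \<phi> z\<^sub>0 z"
      if z: "0 < z" "phi_conj \<phi> (z\<^sub>0 + z) < \<infinity>" for z\<^sub>0 z
    proof -
      obtain a b where ab: "phi_conj \<phi> (z\<^sub>0 + z) = ereal a" "phi_conj \<phi> z\<^sub>0 = ereal b"
        "z\<^sub>0 + z \<le> a" "z\<^sub>0 \<le> b" "b \<le> a"
        using phi_conj_finite_cases[OF gen z] .
      have 1: "(1 - p) * (a - b) \<le> a - z\<^sub>0 - q * z + d"
        using phi_conj_weak_duality[OF _ _ q ab(1,2), of p] p d(2) by simp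
      \<comment> \<open>Weak duality at the diagonal point \<open>(r, r)\<close>, with divergence
        zero, needs only the bounds of the conjugate from below by its slopes.\<close>
      have "r * (z\<^sub>0 + z) + (1 - r) * z\<^sub>0 \<le> r * a + (1 - r) * b" if "0 \<le> r" "r \<le> 1" for r
        using that ab by (intro add_mono mult_left_mono) auto
      from this[of "p / 2"] have 2: "(1 - p / 2) * (a - b) \<le> a - z\<^sub>0 - p / 2 * z"
        using p by (simp add: field_simps)
      have "(1 - p') * (a - b) = (1 - s) * ((1 - p) * (a - b)) + s * ((1 - p / 2) * (a - b))"
        by (simp add: p'_def algebra_simps)
      also have "\<dots> \<le> (1 - s) * (a - z\<^sub>0 - q * z + d) + s * (a - z\<^sub>0 - p / 2 * z)"
        using s 1 2 by (intro add_mono mult_left_mono) auto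
      also have "\<dots> = a - z\<^sub>0 - \<epsilon> * z + d - s * d - s * z * (1 - q + p / 2)"
        by (simp add: s_def field_simps)
      also have "\<dots> \<le> a - z\<^sub>0 - \<epsilon> * z + d"
      proof -
        have "0 \<le> s * d" "0 \<le> s * z * (1 - q + p / 2)"
          using s d z p q by (auto intro!: mult_nonneg_nonneg)
        then show ?thesis
          by linarith
      qed
      finally show ?thesis
        using ab(5) by (auto simp: eps_quotient_eq[OF ab(1,2)] pos_le_divide_eq)
    qed
    then have "ereal (1 - p') \<le> Inf {eps_quotient \<epsilon> (ereal d) \<phi> z\<^sub>0 z | z\<^sub>0 z.
        0 < z \<and> m_lower \<phi> \<le> ereal (z\<^sub>0 + z) \<and> ereal (z\<^sub>0 + z) \<le> m_upper \<phi> \<and>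
        phi_conj \<phi> (z\<^sub>0 + z) < \<infinity>}" (is "_ \<le> ?I")
      by (auto intro!: Inf_greatest)
    then have "1 - ?I \<le> 1 - ereal (1 - p')"
      by (intro ereal_minus_mono order_refl)
    \<comment> \<open>As \<open>\<epsilon> < q \<le> 1\<close>, the constant branch of
      \<open>eps_adj\<close> is excluded, and \<open>p' > 0\<close> absorbs the maximum with
      0.\<close>
    then have "eps_adj \<epsilon> (ereal d) \<phi> \<le> ereal p'"
      using p' s q \<open>\<not> q \<le> \<epsilon>\<close> by (simp add: eps_adj_def one_ereal_def)
    then have "ereal \<delta> \<le> ereal p'"
      by (rule order_trans[OF \<epsilon>(2)])
    then show False
      using p p' by simp
  qed
  then show ?thesis
    unfolding eps_adj_inv_def by (auto intro!: Inf_greatest)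
qed

text \<open>The radius is a summand of the numerator over a nonnegative denominator, so the
  quotients and their infimum grow with it.\<close>

lemma eps_adj_antimono:
  assumes gen: "divergence_generator \<phi>" and "d \<le> d'"
  shows "eps_adj \<epsilon> (ereal d') \<phi> \<le> eps_adj \<epsilon> (ereal d) \<phi>"
proof -
  have quotient_mono: "eps_quotient \<epsilon> (ereal d) \<phi> z\<^sub>0 z \<le> eps_quotient \<epsilon> (ereal d') \<phi> z\<^sub>0 z"
    if z: "0 < z" "phi_conj \<phi> (z\<^sub>0 + z) < \<infinity>" for z\<^sub>0 z
  proof -
    obtain a b where "phi_conj \<phi> (z\<^sub>0 + z) = ereal a" "phi_conj \<phi> z\<^sub>0 = ereal b" "b \<le> a"
      using phi_conj_finite_cases[OF gen z] .
    then show ?thesis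
      using assms(2) by (simp add: eps_quotient_eq divide_right_mono)
  qed
  let ?S = "\<lambda>d. {eps_quotient \<epsilon> (ereal d) \<phi> z\<^sub>0 z | z\<^sub>0 z.
        0 < z \<and> m_lower \<phi> \<le> ereal (z\<^sub>0 + z) \<and> ereal (z\<^sub>0 + z) \<le> m_upper \<phi> \<and>
        phi_conj \<phi> (z\<^sub>0 + z) < \<infinity>}"
  have "Inf (?S d) \<le> Inf (?S d')"
    by (rule Inf_mono) (use quotient_mono in blast)
  then have "1 - Inf (?S d') \<le> 1 - Inf (?S d)"
    by (intro ereal_minus_mono order_refl)
  then show ?thesis
    unfolding eps_adj_def by (simp only: max.mono order_refl split: if_split) blast
qed

lemma eps_adj_inv_mono:
  assumes "divergence_generator \<phi>" "d \<le> d'"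
  shows "eps_adj_inv x (ereal d) \<phi> \<le> eps_adj_inv x (ereal d') \<phi>"
  unfolding eps_adj_inv_def
  by (rule Inf_superset_mono) (use eps_adj_antimono[OF assms] order_trans in blast)

text \<open>Data processing bounds the two-point divergence at each pair of masses of
  \<open>A\<close> under \<open>P\<^sub>0\<close> and \<open>Q\<close> by \<open>d\<close>;
  \<open>le_eps_adj_inv\<close> then bounds the mass under \<open>Q\<close>.\<close>

lemma worst_mass_phi_ball_le_eps_adj_inv:
  assumes gen: "divergence_generator \<phi>" and P0: "P\<^sub>0 \<in> prob_measures"
    and \<delta>: "\<delta> < 1" and d: "0 \<le> d"
  shows "worst_mass P\<^sub>0 (phi_ball \<phi> P\<^sub>0 (ereal d)) \<delta> \<le> eps_adj_inv \<delta> (ereal d) \<phi>"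
proof -
  interpret P0: prob_space P\<^sub>0
    using P0 by (simp add: space_prob_algebra)
  have "ereal (measure Q A) \<le> eps_adj_inv \<delta> (ereal d) \<phi>"
    if Q: "Q \<in> phi_ball \<phi> P\<^sub>0 (ereal d)" and A: "A \<in> sets P\<^sub>0" "measure P\<^sub>0 A \<le> \<delta>" for Q A
  proof (cases "measure P\<^sub>0 A = 0")
    case True
    then have "A \<in> null_sets P\<^sub>0"
      using A(1) by (intro null_setsI) (auto simp: P0.emeasure_eq_measure)
    then have "A \<in> null_sets Q"
      using in_phi_ballD(3)[OF Q] by (auto simp: absolutely_continuous_def)
    then show ?thesis
      by (auto simp: measure_def null_setsD1 eps_adj_inv_def intro!: Inf_greatest)
  next
    case False
    then have p: "0 < measure P\<^sub>0 A"
      using measure_nonneg[of P\<^sub>0 A] by linarith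
    show ?thesis
      using in_phi_ballD[OF Q] P0 A \<delta> d p
      by (intro le_eps_adj_inv[OF gen p] binary_div_le_phi_div[OF gen P0.prob_space_axioms])
        (auto simp: space_prob_algebra prob_space.prob_le_1)
  qed
  then show ?thesis
    unfolding worst_mass_def by (auto intro!: Sup_least)
qed

section \<open>Chaining the comparisons through the data-driven radius\<close>

theorem theorem4p1p1:
  fixes P :: "real ^ 'd \<Rightarrow> (real ^ 'k) measure"
    and \<Theta> :: "(real ^ 'd) set"
    and \<theta>hat :: "real ^ 'd"
    and P\<^sub>0 :: "(real ^ 'k) measure"
    and \<phi> :: "real \<Rightarrow> real"
    and lam \<delta> :: real
    and U_data :: "(real ^ 'k) measure set"
  assumes "divergence_generator \<phi>"
    and "\<And>\<theta>. \<theta> \<in> \<Theta> \<Longrightarrow> P \<theta> \<in> prob_measures"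
    and "\<theta>hat \<in> \<Theta>"
    and "\<exists>f \<in> borel_measurable lborel. P \<theta>hat = density lborel f"
    and "0 < lam" and "0 < \<delta>" and "\<delta> < 1"
    and U_data: "U_data = phi_ball \<phi> (P \<theta>hat) (ereal lam) \<inter> P ` \<Theta>"
    and "P\<^sub>0 \<in> prob_measures"
    and "data_radius U_data P\<^sub>0 \<phi> < ereal lam"
  shows "((INF P\<^sub>1\<in>prob_measures. worst_mass P\<^sub>1 U_data \<delta>)
           \<le> (INF P\<^sub>1\<in>prob_measures. worst_mass P\<^sub>1 (phi_ball \<phi> P\<^sub>0 (data_radius U_data P\<^sub>0 \<phi>)) \<delta>) \<and>
         (INF P\<^sub>1\<in>prob_measures. worst_mass P\<^sub>1 (phi_ball \<phi> P\<^sub>0 (data_radius U_data P\<^sub>0 \<phi>)) \<delta>)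
           \<le> (INF P\<^sub>1\<in>prob_measures. worst_mass P\<^sub>1 (phi_ball \<phi> (P \<theta>hat) (ereal lam)) \<delta>)) \<and>
         ((INF P\<^sub>1\<in>prob_measures. worst_mass P\<^sub>1 U_data \<delta>)
           \<le> eps_adj_inv \<delta> (data_radius U_data P\<^sub>0 \<phi>) \<phi> \<and>
         eps_adj_inv \<delta> (data_radius U_data P\<^sub>0 \<phi>) \<phi> \<le> eps_adj_inv \<delta> (ereal lam) \<phi>)"
proof -
  note gen = assms(1)
  let ?D = "data_radius U_data P\<^sub>0 \<phi>"
  let ?ball0 = "phi_ball \<phi> P\<^sub>0 ?D"
  have P: "P \<theta>hat \<in> prob_measures"
    using assms(2,3) .
  \<comment> \<open>The centre keeps the supremum from ranging over the empty set, where it would be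
    minus infinity; hence the radius is a nonnegative real.\<close>
  have "P \<theta>hat \<in> U_data"
    using self_in_phi_ball[OF gen P, of "ereal lam"] assms(3,5) by (auto simp: U_data)
  then have "phi_div \<phi> P\<^sub>0 (P \<theta>hat) \<le> ?D"
    unfolding data_radius_def by (rule SUP_upper)
  moreover have "0 \<le> phi_div \<phi> P\<^sub>0 (P \<theta>hat)"
    by (simp add: phi_div_def)
  ultimately have "0 \<le> ?D"
    by (rule order_trans[rotated])
  then obtain d where d: "?D = ereal d" "0 \<le> d" "d \<le> lam"
    using assms(10) by (cases ?D) auto
  have sub: "U_data \<subseteq> ?ball0"
  proof
    fix Q assume Q: "Q \<in> U_data"
    then have "phi_div \<phi> P\<^sub>0 Q \<le> ?D"
      unfolding data_radius_def by (rule SUP_upper)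
    \<comment> \<open>A finite radius rules out the value \<infinity> assigned in the absence of
      absolute continuity.\<close>
    moreover from this have "absolutely_continuous P\<^sub>0 Q"
      using d by (auto simp: phi_div_def split: if_splits)
    moreover have "Q \<in> prob_measures"
      using Q by (auto simp: U_data phi_ball_def)
    ultimately show "Q \<in> ?ball0"
      by (simp add: phi_ball_def)
  qed
  obtain e :: "real ^ 'k" where "e \<in> Basis"
    using nonempty_Basis by blast
  then have e: "e \<noteq> 0"
    by (rule nonzero_Basis)
  obtain f where f: "f \<in> borel_measurable lborel" "P \<theta>hat = density lborel f"
    using assms(4) by blast
  have null: "measure (P \<theta>hat) {x. e \<bullet> x = t} = 0" for t
    using measure_hyperplane_density_lborel[OF f(1) e] f(2) by simp
  have le_ball: "worst_mass P\<^sub>0 ?ball0 \<delta> \<le> worst_mass P\<^sub>1 (phi_ball \<phi> (P \<theta>hat) (ereal lam)) \<delta>"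
    if "P\<^sub>1 \<in> prob_measures" for P\<^sub>1
    using worst_mass_phi_ball_le[OF gen P assms(9) that _ null assms(6,7) d(2,3)] by (simp add: d(1))
  have 1: "(INF P\<^sub>1\<in>prob_measures. worst_mass P\<^sub>1 U_data \<delta>)
      \<le> (INF P\<^sub>1\<in>prob_measures. worst_mass P\<^sub>1 ?ball0 \<delta>)"
    by (intro INF_mono' worst_mass_mono sub)
  \<comment> \<open>With \<open>P\<^sub>0\<close> as tester, the worst mass of its ball bounds the
    middle infimum; this one number lies below both the last infimum and the inverse level.\<close>
  have 2: "(INF P\<^sub>1\<in>prob_measures. worst_mass P\<^sub>1 ?ball0 \<delta>) \<le> worst_mass P\<^sub>0 ?ball0 \<delta>"
    using assms(9) by (rule INF_lower)
  have "worst_mass P\<^sub>0 ?ball0 \<delta> \<le> eps_adj_inv \<delta> ?D \<phi>"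
    using worst_mass_phi_ball_le_eps_adj_inv[OF gen assms(9,7) d(2)] by (simp add: d(1))
  moreover have "worst_mass P\<^sub>0 ?ball0 \<delta>
      \<le> (INF P\<^sub>1\<in>prob_measures. worst_mass P\<^sub>1 (phi_ball \<phi> (P \<theta>hat) (ereal lam)) \<delta>)"
    by (rule INF_greatest) (rule le_ball)
  moreover have "eps_adj_inv \<delta> ?D \<phi> \<le> eps_adj_inv \<delta> (ereal lam) \<phi>"
    using eps_adj_inv_mono[OF gen d(3)] by (simp add: d(1))
  ultimately show ?thesis
    using 1 2 by (meson order_trans)
qed

end
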